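(* A minimal $2$-IET has no non-trivial continuous embedding into a $2$-PWI. That is, if $(I,f)$ is a minimal $2$-IET and $h$ is a continuous embedding of $(I,f)$ into a $2$-PWI $(X,T)$, then $h$ is trivial (a linear embedding or an arc embedding).
   Context: IETs. Let $d\ge 2$, let $\pi$ be an irreducible permutation of $\{1,\dots,d\}$ (i.e. $\pi(\{1,\dots,k\})\ne\{1,\dots,k\}$ for $1\le k<d$), and let $\mu=(\mu_1,\dots,\mu_d)$ have positive real entries. Put $x_0=0$, $x_j=\sum_{k=1}^j\mu_k$, $I=[x_0,x_d)$, $I_j=[x_{j-1},x_j)$, and $\tau_j=\sum_{\pi(k)<\pi(j)}\mu_k-\sum_{k<j}\mu_k$. The $d$-interval exchange transformation ($d$-IET) $(I,f)$, $f=f_{\mu,\pi}:I\to I$, is the bijection $f(x)=x+\tau_j$ for $x\in I_j$. It is minimal if every orbit of $f$ is dense in $I$. PWIs. A $d$-PWI (orientation preserving planar piecewise isometry) $(X,T)$ consists of a set $X\subset\mathbb{C}$, a partition of $X$ into pairwise disjoint convex sets (atoms) $X_1,\dots,X_d$, and a map $T:X\to\mathbb{C}$ with $T(z)=e^{i\theta_j}z+\lambda_j$ for $z\in X_j$, where $\theta_j\in[0,2\pi)$, $\lambda_j\in\mathbb{C}$. (Points of $X$ may leave $X$ under $T$.) Embeddings. An injective map $h:I\to X$ is a piecewise continuous embedding of $(I,f)$ into $(X,T)$ if $h(I)$ is an invariant set for $(X,T)$, $h|_{I_j}$ is a homeomorphism onto its image and $h(I_j)\subset X_j$ for each $j$,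 and $h\circ f(x)=T\circ h(x)$ for all $x\in I$. It is a continuous embedding if moreover $h$ is continuous on $I$. A piecewise continuous embedding is a linear embedding if there are $z_j,v_j\in\mathbb{C}$ with $h(x)=z_j+v_jx$ for all $x\in I_j$ and all $j$; it is an arc embedding if there are $z_j\in\mathbb{C}$, $r_j>0$, $a_j,b_j\in\mathbb{R}$ with $h(x)=z_j+r_j\exp[i(a_jx+b_j)]$ for all $x\in I_j$ and all $j$. It is trivial if it is a linear embedding or an arc embedding, and non-trivial otherwise. *)

theory Defs
  imports "HOL-Analysis.Analysis" "HOL-Combinatorics.Permutations"
begin

section \<open>Interval exchange transformations\<close>

definition irreducible_perm :: "nat \<Rightarrow> (nat \<Rightarrow> nat) \<Rightarrow> bool" where
  "irreducible_perm d \<pi> \<longleftrightarrow>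
     \<pi> permutes {1..d} \<and> (\<forall>k. 1 \<le> k \<and> k < d \<longrightarrow> \<pi> ` {1..k} \<noteq> {1..k})"

definition iet_data :: "nat \<Rightarrow> (nat \<Rightarrow> real) \<Rightarrow> (nat \<Rightarrow> nat) \<Rightarrow> bool" where
  "iet_data d \<mu> \<pi> \<longleftrightarrow> 2 \<le> d \<and> irreducible_perm d \<pi> \<and> (\<forall>j\<in>{1..d}. 0 < \<mu> j)"

definition iet_endpoint :: "(nat \<Rightarrow> real) \<Rightarrow> nat \<Rightarrow> real" where
  "iet_endpoint \<mu> j = (\<Sum>k=1..j. \<mu> k)"

definition iet_domain :: "nat \<Rightarrow> (nat \<Rightarrow> real) \<Rightarrow> real set" where
  "iet_domain d \<mu> = {iet_endpoint \<mu> 0 ..< iet_endpoint \<mu> d}"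

text \<open>Only used for indices \<open>j \<ge> 1\<close>.\<close>

definition iet_interval :: "(nat \<Rightarrow> real) \<Rightarrow> nat \<Rightarrow> real set" where
  "iet_interval \<mu> j = {iet_endpoint \<mu> (j - 1) ..< iet_endpoint \<mu> j}"

definition iet_shift :: "nat \<Rightarrow> (nat \<Rightarrow> real) \<Rightarrow> (nat \<Rightarrow> nat) \<Rightarrow> nat \<Rightarrow> real" where
  "iet_shift d \<mu> \<pi> j =
     (\<Sum>k\<in>{k\<in>{1..d}. \<pi> k < \<pi> j}. \<mu> k) - (\<Sum>k\<in>{1..<j}. \<mu> k)"

text \<open>The value is arbitrary outside \<open>iet_domain d \<mu>\<close>.\<close>

definition iet_map :: "nat \<Rightarrow> (nat \<Rightarrow> real) \<Rightarrow> (nat \<Rightarrow> nat) \<Rightarrow> real \<Rightarrow> real" where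
  "iet_map d \<mu> \<pi> x =
     x + iet_shift d \<mu> \<pi> (THE j. j \<in> {1..d} \<and> x \<in> iet_interval \<mu> j)"

lemma iet_interval_unique:
  assumes pos: "\<forall>j\<in>{1..d}. 0 < \<mu> j"
    and "j \<in> {1..d}" "k \<in> {1..d}" "x \<in> iet_interval \<mu> j" "x \<in> iet_interval \<mu> k"
  shows "j = k"
proof -
  have mono: "iet_endpoint \<mu> m \<le> iet_endpoint \<mu> n" if "m \<le> n" "n \<le> d" for m n
    unfolding iet_endpoint_def using that pos
    by (intro sum_mono2) (auto intro: less_imp_le)
  have "\<not> a < b" if "a \<in> {1..d}" "b \<in> {1..d}"
      "x \<in> iet_interval \<mu> a" "x \<in> iet_interval \<mu> b" for a b
    using mono[of a "b - 1"] that unfolding iet_interval_def by fastforce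
  then show ?thesis
    using assms by (meson linorder_neqE_nat)
qed

lemma iet_map_eq:
  assumes "\<forall>j\<in>{1..d}. 0 < \<mu> j" "j \<in> {1..d}" "x \<in> iet_interval \<mu> j"
  shows "iet_map d \<mu> \<pi> x = x + iet_shift d \<mu> \<pi> j"
proof -
  have "(THE j. j \<in> {1..d} \<and> x \<in> iet_interval \<mu> j) = j"
    using assms iet_interval_unique[OF assms(1)] by (intro the_equality) blast+
  then show ?thesis
    by (simp add: iet_map_def)
qed

text \<open>For a bijection \<open>f\<close> of \<open>I\<close> this is the full orbit, over all integer iterates.\<close>

definition orbit_in :: "'a set \<Rightarrow> ('a \<Rightarrow> 'a) \<Rightarrow> 'a \<Rightarrow> 'a set" where
  "orbit_in I f x = {y\<in>I. \<exists>n. (f ^^ n) x = y \<or> (f ^^ n) y = x}"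

definition minimal_iet :: "nat \<Rightarrow> (nat \<Rightarrow> real) \<Rightarrow> (nat \<Rightarrow> nat) \<Rightarrow> bool" where
  "minimal_iet d \<mu> \<pi> \<longleftrightarrow> iet_data d \<mu> \<pi> \<and>
     (\<forall>x\<in>iet_domain d \<mu>.
        iet_domain d \<mu> \<subseteq> closure (orbit_in (iet_domain d \<mu>) (iet_map d \<mu> \<pi>) x))"

section \<open>Planar piecewise isometries\<close>

text \<open>
  \<open>A 1, \<dots>, A d\<close> are the atoms. The map \<open>T\<close> is relevant on \<open>X\<close> only and need not send
  \<open>X\<close> into itself.
\<close>

definition pwi :: "nat \<Rightarrow> complex set \<Rightarrow> (nat \<Rightarrow> complex set) \<Rightarrow> (complex \<Rightarrow> complex) \<Rightarrow> bool" where
  "pwi d X A T \<longleftrightarrow>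
     (\<Union>j\<in>{1..d}. A j) = X \<and> disjoint_family_on A {1..d} \<and>
     (\<forall>j\<in>{1..d}. A j \<noteq> {} \<and> convex (A j)) \<and>
     (\<exists>(\<theta> :: nat \<Rightarrow> real) (t :: nat \<Rightarrow> complex). \<forall>j\<in>{1..d}. \<theta> j \<in> {0..<2 * pi} \<and>
        (\<forall>z\<in>A j. T z = exp (\<i> * complex_of_real (\<theta> j)) * z + t j))"

definition invariant_set :: "complex set \<Rightarrow> (complex \<Rightarrow> complex) \<Rightarrow> complex set \<Rightarrow> bool" where
  "invariant_set X T S \<longleftrightarrow> S \<subseteq> X \<and> T ` S \<subseteq> S"

section \<open>Embeddings of interval exchanges into piecewise isometries\<close>

definition pw_continuous_embedding ::
  "nat \<Rightarrow> (nat \<Rightarrow> real) \<Rightarrow> (nat \<Rightarrow> nat) \<Rightarrow>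
   complex set \<Rightarrow> (nat \<Rightarrow> complex set) \<Rightarrow> (complex \<Rightarrow> complex) \<Rightarrow> (real \<Rightarrow> complex) \<Rightarrow> bool" where
  "pw_continuous_embedding d \<mu> \<pi> X A T h \<longleftrightarrow>
     inj_on h (iet_domain d \<mu>) \<and>
     invariant_set X T (h ` iet_domain d \<mu>) \<and>
     (\<forall>j\<in>{1..d}. (\<exists>g. homeomorphism (iet_interval \<mu> j) (h ` iet_interval \<mu> j) h g) \<and>
        h ` iet_interval \<mu> j \<subseteq> A j) \<and>
     (\<forall>x\<in>iet_domain d \<mu>. h (iet_map d \<mu> \<pi> x) = T (h x))"

definition continuous_embedding ::
  "nat \<Rightarrow> (nat \<Rightarrow> real) \<Rightarrow> (nat \<Rightarrow> nat) \<Rightarrow>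
   complex set \<Rightarrow> (nat \<Rightarrow> complex set) \<Rightarrow> (complex \<Rightarrow> complex) \<Rightarrow> (real \<Rightarrow> complex) \<Rightarrow> bool" where
  "continuous_embedding d \<mu> \<pi> X A T h \<longleftrightarrow>
     pw_continuous_embedding d \<mu> \<pi> X A T h \<and> continuous_on (iet_domain d \<mu>) h"

definition linear_embedding ::
  "nat \<Rightarrow> (nat \<Rightarrow> real) \<Rightarrow> (nat \<Rightarrow> nat) \<Rightarrow>
   complex set \<Rightarrow> (nat \<Rightarrow> complex set) \<Rightarrow> (complex \<Rightarrow> complex) \<Rightarrow> (real \<Rightarrow> complex) \<Rightarrow> bool" where
  "linear_embedding d \<mu> \<pi> X A T h \<longleftrightarrow>
     pw_continuous_embedding d \<mu> \<pi> X A T h \<and>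
     (\<exists>z v :: nat \<Rightarrow> complex. \<forall>j\<in>{1..d}. \<forall>x\<in>iet_interval \<mu> j.
        h x = z j + v j * complex_of_real x)"

definition arc_embedding ::
  "nat \<Rightarrow> (nat \<Rightarrow> real) \<Rightarrow> (nat \<Rightarrow> nat) \<Rightarrow>
   complex set \<Rightarrow> (nat \<Rightarrow> complex set) \<Rightarrow> (complex \<Rightarrow> complex) \<Rightarrow> (real \<Rightarrow> complex) \<Rightarrow> bool" where
  "arc_embedding d \<mu> \<pi> X A T h \<longleftrightarrow>
     pw_continuous_embedding d \<mu> \<pi> X A T h \<and>
     (\<exists>(z :: nat \<Rightarrow> complex) (r :: nat \<Rightarrow> real) (a :: nat \<Rightarrow> real) (b :: nat \<Rightarrow> real).
        \<forall>j\<in>{1..d}. 0 < r j \<and> (\<forall>x\<in>iet_interval \<mu> j.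
          h x = z j + complex_of_real (r j) * exp (\<i> * complex_of_real (a j * x + b j))))"

definition trivial_embedding ::
  "nat \<Rightarrow> (nat \<Rightarrow> real) \<Rightarrow> (nat \<Rightarrow> nat) \<Rightarrow>
   complex set \<Rightarrow> (nat \<Rightarrow> complex set) \<Rightarrow> (complex \<Rightarrow> complex) \<Rightarrow> (real \<Rightarrow> complex) \<Rightarrow> bool" where
  "trivial_embedding d \<mu> \<pi> X A T h \<longleftrightarrow>
     linear_embedding d \<mu> \<pi> X A T h \<or> arc_embedding d \<mu> \<pi> X A T h"

end

theory Submission
  imports Defs
begin

text \<open>
  The only irreducible permutation of two symbols is the transposition, so a 2-IET is a circle
  rotation cut open at one point: \<open>x \<mapsto> x + b\<close> on \<open>[0, a)\<close> and \<open>x \<mapsto> x - a\<close> on \<open>[a, a + b)\<close>.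

  The point \<open>b\<close> is reached from the cut in two ways: as the second image of \<open>a\<close>, passing
  through \<open>0\<close>, and, in the limit from the left, by going from \<open>a\<close> up to the right end and then
  back to \<open>b\<close>. Along a continuous embedding \<open>h\<close> the first way applies the second isometry and then
  the first one to \<open>h a\<close>, and the other way applies them in the opposite order. So the two isometries
  commute at \<open>h a\<close> (\<open>two_iet.branches_commute_at_break\<close>), and this forces them to be either two
  translations or two rotations about a common centre \<open>c\<close> (\<open>commuting_affine_maps\<close>).

  For translations, \<open>h\<close> changes by a constant under each branch of \<open>f\<close>. Subtracting
  a linear function makes the two constants equal, hence zero because \<open>h\<close> is bounded; what is left is
  a continuous function invariant under a minimal map, so it is constant and \<open>h\<close> is affine
  (\<open>two_iet.affine_if_constant_increments\<close>). For rotations, the distance of \<open>h\<close> to \<open>c\<close> is a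
  continuous invariant function and therefore constant, so \<open>h\<close> runs in a circle around \<open>c\<close>. The
  same argument applied to a continuous logarithm of \<open>h - c\<close> shows that the angle is affine.
\<close>

section \<open>Commuting orientation preserving isometries of the plane\<close>

text \<open>
  The difference of the two compositions does not depend on the point, so commuting at a single point
  is the same as \<open>(1 - u) * q = (1 - v) * p\<close>, which says that the fixed point of one map is also
  fixed by the other.
\<close>

lemma commuting_affine_maps:
  fixes u v p q z :: "'a::field"
  assumes "u * (v * z + q) + p = v * (u * z + p) + q"
  obtains "u = 1" "v = 1"
  | c where "\<And>w. u * w + p - c = u * (w - c)" "\<And>w. v * w + q - c = v * (w - c)"
proof -
  have comm: "(1 - u) * q = (1 - v) * p"
    using assms by (simp add: algebra_simps)
  consider "u = 1" "v = 1" | "u \<noteq> 1" | "v \<noteq> 1" by blast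
  then show thesis
  proof cases
    case 1
    then show thesis by (rule that(1))
  next
    case 2
    then have "u * (p / (1 - u)) + p = p / (1 - u)" "v * (p / (1 - u)) + q = p / (1 - u)"
      using comm by (simp_all add: field_simps)
    then show thesis
      by (intro that(2)[of "p / (1 - u)"]) (simp_all add: algebra_simps)
  next
    case 3
    then have "u * (q / (1 - v)) + p = q / (1 - v)" "v * (q / (1 - v)) + q = q / (1 - v)"
      using comm by (simp_all add: field_simps)
    then show thesis
      by (intro that(2)[of "q / (1 - v)"]) (simp_all add: algebra_simps)
  qed
qed

section \<open>Minimal exchanges of two intervals\<close>

locale two_iet =
  fixes a b :: real and f :: "real \<Rightarrow> real"
  assumes a_pos: "0 < a" and b_pos: "0 < b"
    and f_left: "\<And>x. x \<in> {0..<a} \<Longrightarrow> f x = x + b"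
    and f_right: "\<And>x. x \<in> {a..<a + b} \<Longrightarrow> f x = x - a"
    and dense_orbits: "\<And>x. x \<in> {0..<a + b} \<Longrightarrow> {0..<a + b} \<subseteq> closure (orbit_in {0..<a + b} f x)"
begin

lemma f_in: "x \<in> {0..<a + b} \<Longrightarrow> f x \<in> {0..<a + b}"
  using f_left[of x] f_right[of x] a_pos b_pos by (cases "x < a") auto

lemma funpow_in: "x \<in> {0..<a + b} \<Longrightarrow> (f ^^ n) x \<in> {0..<a + b}"
  by (induction n) (use f_in in auto)

lemma branch_cases:
  assumes "x \<in> {0..<a + b}"
  obtains "x \<in> {0..<a}" "f x = x + b" | "x \<in> {a..<a + b}" "f x = x - a"
  using assms f_left[of x] f_right[of x] by (cases "x < a") auto

lemma invariant_continuous_constant: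
  fixes \<phi> :: "real \<Rightarrow> 'a::t1_space"
  assumes cont: "continuous_on {0..<a + b} \<phi>"
    and inv: "\<And>x. x \<in> {0..<a + b} \<Longrightarrow> \<phi> (f x) = \<phi> x"
    and x: "x \<in> {0..<a + b}" and y: "y \<in> {0..<a + b}"
  shows "\<phi> y = \<phi> x"
proof -
  have pow: "\<phi> ((f ^^ n) z) = \<phi> z" if "z \<in> {0..<a + b}" for n z
    by (induction n) (use inv funpow_in that in auto)
  have "closedin (top_of_set {0..<a + b}) {z \<in> {0..<a + b}. \<phi> z = \<phi> x}"
    using cont by (rule continuous_closedin_preimage_constant)
  then obtain C where C: "closed C" "{z \<in> {0..<a + b}. \<phi> z = \<phi> x} = {0..<a + b} \<inter> C"
    unfolding closedin_closed by blast
  have "orbit_in {0..<a + b} f x \<subseteq> C"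
  proof
    fix z assume "z \<in> orbit_in {0..<a + b} f x"
    then obtain n where z: "z \<in> {0..<a + b}" "(f ^^ n) x = z \<or> (f ^^ n) z = x"
      unfolding orbit_in_def by blast
    then have "\<phi> z = \<phi> x"
      using pow[OF x, of n] pow[OF z(1), of n] by auto
    then show "z \<in> C"
      using z(1) C(2) by blast
  qed
  then have "{0..<a + b} \<subseteq> C"
    using dense_orbits[OF x] closure_minimal[OF _ C(1)] by blast
  then show ?thesis
    using y C(2) by blast
qed

text \<open>
  The slope \<open>s\<close> below is the one for which subtracting \<open>x *\<^sub>R s\<close> turns both increments into the
  same \<open>\<gamma>\<close>. Boundedness comes from the exchange itself: the values near the right end
  are those near \<open>a\<close>, shifted by \<open>\<alpha>\<close>.
\<close>

lemma affine_if_constant_increments: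
  fixes g :: "real \<Rightarrow> 'a::real_normed_vector"
  assumes cont: "continuous_on {0..<a + b} g"
    and left: "\<And>x. x \<in> {0..<a} \<Longrightarrow> g (x + b) = g x + \<alpha>"
    and right: "\<And>x. x \<in> {a..<a + b} \<Longrightarrow> g (x - a) = g x + \<beta>"
  obtains s c where "\<And>x. x \<in> {0..<a + b} \<Longrightarrow> g x = c + x *\<^sub>R s"
proof -
  define s where "s = (1 / (a + b)) *\<^sub>R (\<alpha> - \<beta>)"
  define k where "k x = g x - x *\<^sub>R s" for x
  define \<gamma> where "\<gamma> = \<alpha> - b *\<^sub>R s"
  have "(a + b) *\<^sub>R s = \<alpha> - \<beta>"
    using a_pos b_pos by (simp add: s_def)
  then have \<gamma>: "\<gamma> = \<beta> + a *\<^sub>R s"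
    by (simp add: \<gamma>_def algebra_simps)
  have step: "k (f x) = k x + \<gamma>" if "x \<in> {0..<a + b}" for x
    using that
  proof (cases rule: branch_cases)
    case 1
    then show ?thesis
      using left[OF 1(1)] by (simp add: k_def \<gamma>_def scaleR_add_left)
  next
    case 2
    then show ?thesis
      using right[OF 2(1)] by (simp add: k_def \<gamma> scaleR_diff_left)
  qed
  have "bounded (g ` {0..<a + b})"
  proof -
    have "bounded (g ` {0..b})" "bounded (g ` {0..a})"
      using a_pos b_pos
      by (auto intro!: compact_imp_bounded compact_continuous_image continuous_on_subset[OF cont])
    then have "bounded (g ` {0..b} \<union> (\<lambda>y. y + \<alpha>) ` g ` {0..a})"
      using bounded_translation[of "g ` {0..a}" \<alpha>] by (simp add: add.commute)
    moreover have "g ` {0..<a + b} \<subseteq> g ` {0..b} \<union> (\<lambda>y. y + \<alpha>) ` g ` {0..a}"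
    proof (rule image_subsetI)
      fix x assume "x \<in> {0..<a + b}"
      then show "g x \<in> g ` {0..b} \<union> (\<lambda>y. y + \<alpha>) ` g ` {0..a}"
        using left[of "x - b"] by (cases "x \<le> b") auto
    qed
    ultimately show ?thesis
      by (rule bounded_subset)
  qed
  then obtain B where B: "\<And>x. x \<in> {0..<a + b} \<Longrightarrow> norm (g x) \<le> B"
    unfolding bounded_iff by blast
  have k_bound: "norm (k x) \<le> B + (a + b) * norm s" if "x \<in> {0..<a + b}" for x
  proof -
    have "norm (k x) \<le> norm (g x) + norm (x *\<^sub>R s)"
      unfolding k_def by (rule norm_triangle_ineq4)
    also have "\<dots> \<le> B + (a + b) * norm s"
      using that B[OF that] by (auto intro!: add_mono mult_right_mono)
    finally show ?thesis .
  qed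
  have "\<gamma> = 0"
  proof (rule ccontr)
    assume "\<gamma> \<noteq> 0"
    have zero: "0 \<in> {0..<a + b}"
      using a_pos b_pos by simp
    have iter: "k ((f ^^ n) 0) = k 0 + real n *\<^sub>R \<gamma>" for n
      by (induction n) (use step funpow_in[OF zero] in \<open>auto simp: algebra_simps\<close>)
    obtain n where n: "2 * (B + (a + b) * norm s) < real n * norm \<gamma>"
      using \<open>\<gamma> \<noteq> 0\<close> ex_less_of_nat_mult[of "norm \<gamma>"] by auto
    have "real n * norm \<gamma> = norm (k ((f ^^ n) 0) - k 0)"
      by (simp add: iter)
    also have "\<dots> \<le> norm (k ((f ^^ n) 0)) + norm (k 0)"
      by (rule norm_triangle_ineq4)
    also have "\<dots> \<le> 2 * (B + (a + b) * norm s)"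
      using add_mono[OF k_bound[OF funpow_in[OF zero, of n]] k_bound[OF zero]]
      by (simp only: mult_2)
    finally show False
      using n by simp
  qed
  have "k x = k 0" if "x \<in> {0..<a + b}" for x
  proof (rule invariant_continuous_constant)
    show "continuous_on {0..<a + b} k"
      unfolding k_def by (intro continuous_intros cont)
  qed (use step \<open>\<gamma> = 0\<close> that a_pos b_pos in auto)
  then have "g x = k 0 + x *\<^sub>R s" if "x \<in> {0..<a + b}" for x
    using that by (metis k_def diff_add_cancel)
  then show thesis
    by (rule that)
qed

text \<open>
  The function \<open>h\<close> has a limit at the right end, namely \<open>S1 (h a)\<close>. Both sides of the conclusion are
  the value \<open>h b\<close>, computed through the left end and through the right end.
\<close>

lemma branches_commute_at_break:
  fixes h :: "real \<Rightarrow> 'a::t2_space"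
  assumes cont: "continuous_on {0..<a + b} h"
    and S1: "continuous_on UNIV S1" and S2: "continuous_on UNIV S2"
    and left: "\<And>x. x \<in> {0..<a} \<Longrightarrow> h (x + b) = S1 (h x)"
    and right: "\<And>x. x \<in> {a..<a + b} \<Longrightarrow> h (x - a) = S2 (h x)"
  shows "S1 (S2 (h a)) = S2 (S1 (h a))"
proof -
  have isCont_h: "isCont h x" if "0 < x" "x < a + b" for x
  proof -
    have "continuous_on {0<..<a + b} h"
      by (rule continuous_on_subset[OF cont]) auto
    then show ?thesis
      using that by (simp add: continuous_on_eq_continuous_at)
  qed
  have isCont_S: "isCont S1 z" "isCont S2 z" for z
    using S1 S2 by (simp_all add: continuous_on_eq_continuous_at)
  have "((\<lambda>x. h (x - b)) \<longlongrightarrow> h a) (at_left (a + b))"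
    by (rule isCont_tendsto_compose[OF isCont_h]) (use a_pos b_pos in \<open>auto intro!: tendsto_eq_intros\<close>)
  then have "((\<lambda>x. S2 (S1 (h (x - b)))) \<longlongrightarrow> S2 (S1 (h a))) (at_left (a + b))"
    by (intro isCont_tendsto_compose[OF isCont_S(1)] isCont_tendsto_compose[OF isCont_S(2)])
  moreover have "\<forall>\<^sub>F x in at_left (a + b). S2 (S1 (h (x - b))) = h (x - a)"
  proof -
    have "\<forall>\<^sub>F x in at_left (a + b). x \<in> {max a b<..<a + b}"
      using a_pos b_pos by (intro eventually_at_leftI[of "max a b"]) auto
    then show ?thesis
    proof eventually_elim
      case (elim x)
      then show ?case
        using left[of "x - b"] right[of x] by simp
    qed
  qed
  ultimately have "((\<lambda>x. h (x - a)) \<longlongrightarrow> S2 (S1 (h a))) (at_left (a + b))"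
    by (rule Lim_transform_eventually)
  moreover have "((\<lambda>x. h (x - a)) \<longlongrightarrow> h b) (at_left (a + b))"
    by (rule isCont_tendsto_compose[OF isCont_h]) (use a_pos b_pos in \<open>auto intro!: tendsto_eq_intros\<close>)
  ultimately have "S2 (S1 (h a)) = h b"
    by (intro tendsto_unique) auto
  moreover have "S1 (S2 (h a)) = h b"
    using left[of 0] right[of a] a_pos b_pos by simp
  ultimately show ?thesis by simp
qed

end

section \<open>Curves conjugated to rotations about a common centre\<close>

text \<open>The fibres of \<open>exp\<close> are discrete: distinct points of a fibre are at least \<open>2 * pi\<close> apart.\<close>

lemma continuous_exp_constant:
  fixes k :: "'a::topological_space \<Rightarrow> complex"
  assumes "connected S" "continuous_on S k" "\<And>x. x \<in> S \<Longrightarrow> exp (k x) = u"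
  obtains \<alpha> where "\<And>x. x \<in> S \<Longrightarrow> k x = \<alpha>"
proof -
  have "k constant_on S"
    using assms(1,2)
  proof (rule continuous_discrete_range_constant)
    fix x assume "x \<in> S"
    have "2 * pi \<le> norm (k y - k x)" if y: "y \<in> S" "k y \<noteq> k x" for y
    proof -
      have "exp (k y) = exp (k x)"
        using assms(3) \<open>x \<in> S\<close> y(1) by simp
      then obtain n :: int where n: "k y = k x + of_int (2 * n) * (of_real pi * \<i>)"
        unfolding exp_eq by (auto simp: mult.assoc)
      with y(2) have "n \<noteq> 0" by auto
      then have "1 \<le> \<bar>real_of_int n\<bar>"
        by linarith
      then show ?thesis
        using n by (simp add: norm_mult)
    qed
    then show "\<exists>e>0. \<forall>y. y \<in> S \<and> k y \<noteq> k x \<longrightarrow> e \<le> norm (k y - k x)"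
      by (intro exI[of _ "2 * pi"]) auto
  qed
  then show thesis
    using that unfolding constant_on_def by blast
qed

text \<open>
  By minimality the distance to \<open>c\<close> is constant along the curve, and an injective curve cannot have
  distance \<open>0\<close> throughout, so \<open>h - c\<close> has a continuous logarithm. Its branch
  increments are logarithms of \<open>u\<close> and \<open>v\<close>, hence constant by connectedness.
\<close>

lemma (in two_iet) circular_arc_if_rotations:
  fixes h :: "real \<Rightarrow> complex"
  assumes cont: "continuous_on {0..<a + b} h" and inj: "inj_on h {0..<a + b}"
    and left: "\<And>x. x \<in> {0..<a} \<Longrightarrow> h (x + b) - c = u * (h x - c)"
    and right: "\<And>x. x \<in> {a..<a + b} \<Longrightarrow> h (x - a) - c = v * (h x - c)"
    and uv: "norm u = 1" "norm v = 1"
  obtains r s t where "0 < r"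
    "\<And>x. x \<in> {0..<a + b} \<Longrightarrow> h x = c + of_real r * exp (\<i> * of_real (s * x + t))"
proof -
  have zero: "0 \<in> {0..<a + b}" and a_in: "a \<in> {0..<a + b}"
    using a_pos b_pos by simp_all
  define r where "r = norm (h 0 - c)"
  have norm_h: "norm (h x - c) = r" if "x \<in> {0..<a + b}" for x
    unfolding r_def
  proof (rule invariant_continuous_constant[where \<phi> = "\<lambda>x. norm (h x - c)"])
    fix y assume "y \<in> {0..<a + b}"
    then show "norm (h (f y) - c) = norm (h y - c)"
      by (cases rule: branch_cases) (use left right uv in \<open>simp_all add: norm_mult\<close>)
  qed (use that zero in \<open>auto intro!: continuous_intros cont\<close>)
  have "r \<noteq> 0"
  proof
    assume "r = 0"
    then have "h 0 = h a"
      using norm_h[OF zero] norm_h[OF a_in] by simp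
    then show False
      using inj zero a_in a_pos by (auto dest: inj_onD)
  qed
  then have "0 < r"
    by (simp add: r_def)
  have "contractible {0..<a + b}"
    by (simp add: convex_imp_contractible)
  moreover have "continuous_on {0..<a + b} (\<lambda>x. h x - c)"
    by (intro continuous_intros cont)
  moreover have "h x - c \<noteq> 0" if "x \<in> {0..<a + b}" for x
    using norm_h[OF that] \<open>0 < r\<close> by auto
  ultimately obtain g where g: "continuous_on {0..<a + b} g"
      "\<And>x. x \<in> {0..<a + b} \<Longrightarrow> h x - c = exp (g x)"
    using continuous_logarithm_on_contractible[of "{0..<a + b}" "\<lambda>x. h x - c"] by metis
  obtain \<alpha> where \<alpha>: "\<And>x. x \<in> {0..<a} \<Longrightarrow> g (x + b) - g x = \<alpha>"
  proof (rule continuous_exp_constant[of "{0..<a}" "\<lambda>x. g (x + b) - g x" u])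
    show "continuous_on {0..<a} (\<lambda>x. g (x + b) - g x)"
      using a_pos b_pos by (auto intro!: continuous_intros continuous_on_compose2[OF g(1)])
    fix x assume x: "x \<in> {0..<a}"
    then have "exp (g (x + b)) = u * exp (g x)"
      using left[OF x] g(2)[of x] g(2)[of "x + b"] b_pos by simp
    then show "exp (g (x + b) - g x) = u"
      by (simp add: exp_diff)
  qed auto
  obtain \<beta> where \<beta>: "\<And>x. x \<in> {a..<a + b} \<Longrightarrow> g (x - a) - g x = \<beta>"
  proof (rule continuous_exp_constant[of "{a..<a + b}" "\<lambda>x. g (x - a) - g x" v])
    show "continuous_on {a..<a + b} (\<lambda>x. g (x - a) - g x)"
      using a_pos b_pos by (auto intro!: continuous_intros continuous_on_compose2[OF g(1)])
    fix x assume x: "x \<in> {a..<a + b}"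
    then have "exp (g (x - a)) = v * exp (g x)"
      using right[OF x] g(2)[of x] g(2)[of "x - a"] a_pos by simp
    then show "exp (g (x - a) - g x) = v"
      by (simp add: exp_diff)
  qed auto
  obtain s d where sd: "\<And>x. x \<in> {0..<a + b} \<Longrightarrow> g x = d + x *\<^sub>R s"
    by (rule affine_if_constant_increments[OF g(1), of \<alpha> \<beta>])
      (use \<alpha> \<beta> in \<open>auto simp: algebra_simps\<close>)
  \<comment> \<open>The curve stays at distance \<open>r\<close> from the centre, so the slope of its logarithm is imaginary.\<close>
  have Re_g: "Re d + x * Re s = ln r" if "x \<in> {0..<a + b}" for x
  proof -
    have "exp (Re (g x)) = r"
      using norm_h[OF that] g(2)[OF that] by simp
    then have "Re (g x) = ln r"
      by (metis ln_exp)
    then show ?thesis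
      using sd[OF that] by simp
  qed
  have "Re s = 0" "Re d = ln r"
    using Re_g[OF zero] Re_g[OF a_in] a_pos by simp_all
  have "h x = c + of_real r * exp (\<i> * of_real (Im s * x + Im d))" if "x \<in> {0..<a + b}" for x
  proof -
    have "g x = of_real (ln r) + \<i> * of_real (Im s * x + Im d)"
      using sd[OF that] \<open>Re s = 0\<close> \<open>Re d = ln r\<close> by (simp add: complex_eq_iff)
    then have "exp (g x) = of_real r * exp (\<i> * of_real (Im s * x + Im d))"
      using \<open>0 < r\<close> by (simp only: exp_add exp_of_real exp_ln)
    then show ?thesis
      using g(2)[OF that] by (simp add: algebra_simps)
  qed
  then show thesis
    using that \<open>0 < r\<close> by blast
qed

section \<open>Embeddings of minimal two-interval exchanges\<close>

lemma irreducible_perm_2: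
  assumes "irreducible_perm 2 \<pi>"
  shows "\<pi> 1 = 2" "\<pi> 2 = 1"
proof -
  have "{1..2} = {1, 2::nat}" by auto
  then have perm: "\<pi> permutes {1, 2}"
    using assms by (simp add: irreducible_perm_def)
  have "\<pi> ` {1..1} \<noteq> {1..1}"
    using assms unfolding irreducible_perm_def by (elim conjE allE[of _ 1]) simp
  then have "\<pi> 1 \<noteq> 1" by simp
  then show "\<pi> 1 = 2"
    using permutes_in_image[OF perm, of 1] by auto
  then show "\<pi> 2 = 1"
    using permutes_in_image[OF perm, of 2] inj_eq[OF permutes_inj[OF perm], of 1 2] by auto
qed

lemma iet_intervals_2:
  "iet_domain 2 \<mu> = {0..<\<mu> 1 + \<mu> 2}"
  "iet_interval \<mu> 1 = {0..<\<mu> 1}"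
  "iet_interval \<mu> 2 = {\<mu> 1..<\<mu> 1 + \<mu> 2}"
  by (simp_all add: iet_domain_def iet_interval_def iet_endpoint_def numeral_2_eq_2)

lemma two_iet_if_minimal:
  assumes "minimal_iet 2 \<mu> \<pi>"
  shows "two_iet (\<mu> 1) (\<mu> 2) (iet_map 2 \<mu> \<pi>)"
proof
  have pos: "\<forall>j\<in>{1..2}. 0 < \<mu> j" and irr: "irreducible_perm 2 \<pi>"
    using assms by (auto simp: minimal_iet_def iet_data_def)
  then show "0 < \<mu> 1" "0 < \<mu> 2" by auto
  note \<pi> = irreducible_perm_2[OF irr]
  have "{k \<in> {1..2}. \<pi> k < \<pi> 1} = {2}"
    using \<pi> by (auto simp: numeral_2_eq_2 le_Suc_eq)
  then have "iet_shift 2 \<mu> \<pi> 1 = \<mu> 2"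
    by (simp add: iet_shift_def)
  then show "iet_map 2 \<mu> \<pi> x = x + \<mu> 2" if "x \<in> {0..<\<mu> 1}" for x
    using iet_map_eq[OF pos, of 1 x \<pi>] that by (simp add: iet_intervals_2[simplified])
  have "{k \<in> {1..2}. \<pi> k < \<pi> 2} = {}"
    using \<pi> by (auto simp: numeral_2_eq_2 le_Suc_eq)
  moreover have "{1..<2::nat} = {1}"
    by auto
  ultimately have "iet_shift 2 \<mu> \<pi> 2 = - \<mu> 1"
    by (simp only: iet_shift_def) simp
  then show "iet_map 2 \<mu> \<pi> x = x - \<mu> 1" if "x \<in> {\<mu> 1..<\<mu> 1 + \<mu> 2}" for x
    using iet_map_eq[OF pos, of 2 x \<pi>] that by (simp add: iet_intervals_2)
  show "{0..<\<mu> 1 + \<mu> 2} \<subseteq> closure (orbit_in {0..<\<mu> 1 + \<mu> 2} (iet_map 2 \<mu> \<pi>) x)"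
    if "x \<in> {0..<\<mu> 1 + \<mu> 2}" for x
    using assms that by (simp add: minimal_iet_def iet_intervals_2)
qed

theorem theorem3p5:
  fixes \<mu> :: "nat \<Rightarrow> real" and \<pi> :: "nat \<Rightarrow> nat"
    and X :: "complex set" and A :: "nat \<Rightarrow> complex set"
    and T :: "complex \<Rightarrow> complex" and h :: "real \<Rightarrow> complex"
  assumes "minimal_iet 2 \<mu> \<pi>"
    and "pwi 2 X A T"
    and "continuous_embedding 2 \<mu> \<pi> X A T h"
  shows "trivial_embedding 2 \<mu> \<pi> X A T h"
proof -
  interpret two_iet "\<mu> 1" "\<mu> 2" "iet_map 2 \<mu> \<pi>"
    using assms(1) by (rule two_iet_if_minimal)
  have emb: "pw_continuous_embedding 2 \<mu> \<pi> X A T h"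
    and cont: "continuous_on {0..<\<mu> 1 + \<mu> 2} h"
    using assms(3) by (auto simp: continuous_embedding_def iet_intervals_2)
  have inj: "inj_on h {0..<\<mu> 1 + \<mu> 2}"
    and conj: "\<And>x. x \<in> {0..<\<mu> 1 + \<mu> 2} \<Longrightarrow> h (iet_map 2 \<mu> \<pi> x) = T (h x)"
    and atoms: "\<And>j. j \<in> {1..2} \<Longrightarrow> h ` iet_interval \<mu> j \<subseteq> A j"
    using emb by (auto simp: pw_continuous_embedding_def iet_intervals_2)
  have in_domain: "x \<in> {0..<\<mu> 1 + \<mu> 2}" if "j \<in> {1..2}" "x \<in> iet_interval \<mu> j" for j x
  proof -
    have "j = 1 \<or> j = 2"
      using that(1) by auto
    then show ?thesis
      using that(2) iet_intervals_2[of \<mu>] a_pos b_pos by auto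
  qed
  obtain \<theta> :: "nat \<Rightarrow> real" and t :: "nat \<Rightarrow> complex" where T:
      "\<And>j z. j \<in> {1..2} \<Longrightarrow> z \<in> A j \<Longrightarrow> T z = exp (\<i> * of_real (\<theta> j)) * z + t j"
    using assms(2) unfolding pwi_def by meson
  define u v where "u = exp (\<i> * of_real (\<theta> 1))" and "v = exp (\<i> * of_real (\<theta> 2))"
  have norm: "norm u = 1" "norm v = 1"
    by (simp_all add: u_def v_def)
  have left: "h (x + \<mu> 2) = u * h x + t 1" if "x \<in> {0..<\<mu> 1}" for x
  proof -
    have "h x \<in> A 1"
      using atoms[of 1] that iet_intervals_2(2)[of \<mu>] by auto
    then show ?thesis
      using T[of 1] conj[of x] f_left[OF that] that b_pos by (simp add: u_def)
  qed
  have right: "h (x - \<mu> 1) = v * h x + t 2" if "x \<in> {\<mu> 1..<\<mu> 1 + \<mu> 2}" for x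
  proof -
    have "h x \<in> A 2"
      using atoms[of 2] that iet_intervals_2(3)[of \<mu>] by auto
    then show ?thesis
      using T[of 2] conj[of x] f_right[OF that] that a_pos by (simp add: v_def)
  qed
  have "u * (v * h (\<mu> 1) + t 2) + t 1 = v * (u * h (\<mu> 1) + t 1) + t 2"
    by (rule branches_commute_at_break[OF cont, where ?S1.0 = "\<lambda>z. u * z + t 1"
          and ?S2.0 = "\<lambda>z. v * z + t 2"]) (use left right in \<open>auto intro!: continuous_intros\<close>)
  then show ?thesis
  proof (cases rule: commuting_affine_maps)
    case 1
    obtain s c where "\<And>x. x \<in> {0..<\<mu> 1 + \<mu> 2} \<Longrightarrow> h x = c + x *\<^sub>R s"
      by (rule affine_if_constant_increments[OF cont, of "t 1" "t 2"]) (use left right 1 in auto)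
    then have "\<forall>j\<in>{1..2}. \<forall>x\<in>iet_interval \<mu> j. h x = c + s * of_real x"
      using in_domain by (metis mult.commute scaleR_conv_of_real)
    then have "linear_embedding 2 \<mu> \<pi> X A T h"
      unfolding linear_embedding_def using emb by (intro conjI exI[of _ "\<lambda>_. c"] exI[of _ "\<lambda>_. s"])
    then show ?thesis
      by (simp add: trivial_embedding_def)
  next
    case (2 c)
    obtain r s q where r: "0 < r"
      and "\<And>x. x \<in> {0..<\<mu> 1 + \<mu> 2} \<Longrightarrow> h x = c + of_real r * exp (\<i> * of_real (s * x + q))"
      by (rule circular_arc_if_rotations[OF cont inj, of c u v]) (use left right 2 norm in auto)
    then have "\<forall>j\<in>{1..2}. 0 < r \<and> (\<forall>x\<in>iet_interval \<mu> j.
        h x = c + of_real r * exp (\<i> * of_real (s * x + q)))"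
      using in_domain by blast
    then have "arc_embedding 2 \<mu> \<pi> X A T h"
      unfolding arc_embedding_def using emb
      by (intro conjI exI[of _ "\<lambda>_. c"] exI[of _ "\<lambda>_. r"] exI[of _ "\<lambda>_. s"] exI[of _ "\<lambda>_. q"])
    then show ?thesis
      by (simp add: trivial_embedding_def)
  qed
qed

end
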